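(* Let $\mathcal H$ be the class of half-planes in $\mathbb R^2$. Any communication protocol with the following properties must have sample complexity at least $\tilde\Omega(\log n)$ for samples of size $n$: (i) whenever the joint sample is realizable by $\mathcal H$ it outputs $1$; (ii) whenever for some $x\in\mathbb R^2$ both $(x,1)$ and $(x,-1)$ belong to the joint sample $S$ it outputs $0$; (iii) it may output anything in the remaining case.
   Context: Half-planes: functions $x\mapsto +1$ if $\langle w,x\rangle\ge b$ and $-1$ otherwise. Examples are pairs in $\mathbb R^2\times\{\pm1\}$; a sample is a finite sequence of examples. Alice receives sample $S_a$, Bob $S_b$, joint sample $S=(S_a,S_b)$ of size $n$ (arbitrary split). A deterministic protocol proceeds by messages, each either a single example from the sender's own input sample or a bit, depending only on the sender's input and previous messages; output determined by the messages; each example or bit costs one unit; sample complexity is the maximum number of units transmitted on inputs of size $n$. $S$ is realizable by $\mathcal H$ if some $h\in\mathcal H$ has $h(x)=y$ for all $(x,y)\in S$. $\tilde\Omega$ hides logarithmic factors. *)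

theory Defs
  imports "HOL-Analysis.Analysis"
begin

text \<open>Examples: a point of the plane together with a label; the label True stands for +1
  and False for -1.\<close>
type_synonym example = "(real^2) \<times> bool"
type_synonym sample = "example list"

definition halfplane :: "real^2 \<Rightarrow> real \<Rightarrow> real^2 \<Rightarrow> bool" where
  "halfplane w b x = (w \<bullet> x \<ge> b)"

definition realizable_hp :: "sample \<Rightarrow> bool" where
  "realizable_hp S = (\<exists>w b. \<forall>(x, y) \<in> set S. halfplane w b x = y)"

definition contradictory :: "sample \<Rightarrow> bool" where
  "contradictory S = (\<exists>x. (x, True) \<in> set S \<and> (x, False) \<in> set S)"

text \<open>Messages: a single example or a single bit. Each costs one unit.\<close>
datatype msg = Ex example | Bit bool

datatype party = Alice | Bob

text \<open>A deterministic protocol: who speaks next (or halting, None) is determined by the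
  transcript; each party's message depends on its own input and the transcript;
  the output depends only on the transcript (True = output 1, False = output 0).\<close>
record protocol =
  speaker :: "msg list \<Rightarrow> party option"
  alice_msg :: "sample \<Rightarrow> msg list \<Rightarrow> msg"
  bob_msg :: "sample \<Rightarrow> msg list \<Rightarrow> msg"
  out :: "msg list \<Rightarrow> bool"

definition msg_ok :: "sample \<Rightarrow> msg \<Rightarrow> bool" where
  "msg_ok S m = (case m of Ex e \<Rightarrow> e \<in> set S | Bit _ \<Rightarrow> True)"

definition valid_protocol :: "protocol \<Rightarrow> bool" where
  "valid_protocol P =
     ((\<forall>S t. msg_ok S (alice_msg P S t)) \<and> (\<forall>S t. msg_ok S (bob_msg P S t)))"

fun run :: "protocol \<Rightarrow> sample \<Rightarrow> sample \<Rightarrow> nat \<Rightarrow> msg list" where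
  "run P Sa Sb 0 = []"
| "run P Sa Sb (Suc k) =
     (let t = run P Sa Sb k in
      case speaker P t of
        None \<Rightarrow> t
      | Some Alice \<Rightarrow> t @ [alice_msg P Sa t]
      | Some Bob \<Rightarrow> t @ [bob_msg P Sb t])"

text \<open>P has sample complexity at most d on inputs of total size n (it halts after at most d
  messages on every such input) and solves the promise problem (i),(ii).\<close>
definition solves_within :: "protocol \<Rightarrow> nat \<Rightarrow> nat \<Rightarrow> bool" where
  "solves_within P n d =
     (valid_protocol P \<and>
      (\<forall>Sa Sb. length Sa + length Sb = n \<longrightarrow>
         (let t = run P Sa Sb d in
           speaker P t = None \<and>
           (realizable_hp (Sa @ Sb) \<longrightarrow> out P t) \<and>
           (contradictory (Sa @ Sb) \<longrightarrow> \<not> out P t))))"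

end

(* Alice's points (label -1) and Bob's points (label +1) encode a pointer-chasing game on an m-ary
   tree: at each level one player holds m subgames while the other points at one of them and holds
   that player's part of it, and the roles alternate. Placing the m subgames at m points of a
   parabola, flattened along the tangents, makes only the subgame pointed at matter: a separating
   line for it separates everything, a common point in it is a common point of the samples.
   The game has at most 4 m^T distinct examples, so among 6 m^T <= n possible messages one keeps a
   1/n fraction of the sender's inputs. If m is a large multiple of log n, such a set still projects
   almost onto most of the m subgames, so a message costs only three levels, and T = 3 d levels
   survive d messages with both answers possible. Hence n < 6 m^(3 d). *)

theory Submission
  imports Defs "HOL-Real_Asymp.Real_Asymp"
begin

section \<open>The tree game\<close>

text \<open>One type serves both players, since the holder of an array at one level holds a pointer
  at the next.\<close>

datatype code = Leaf (leaf_bit: bool) | Array (items: "code list") | Pointer (index: nat) (target: code)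

text \<open>At depth 0 only the pointer holder has a choice, namely the final bit; the array side is
  a dummy.\<close>

fun arrays :: "nat \<Rightarrow> nat \<Rightarrow> code set" and pointers :: "nat \<Rightarrow> nat \<Rightarrow> code set" where
  "arrays m 0 = {Leaf True}"
| "pointers m 0 = {Leaf True, Leaf False}"
| "arrays m (Suc t) = Array ` {xs. set xs \<subseteq> pointers m t \<and> length xs = m}"
| "pointers m (Suc t) = (\<lambda>(i, y). Pointer i y) ` ({..<m} \<times> arrays m t)"

text \<open>The arguments change places in the recursive call: the target is the array of the next
  level, and the entry it selects from the old array is the pointer.\<close>

primrec val :: "nat \<Rightarrow> code \<Rightarrow> code \<Rightarrow> bool" where
  "val 0 v w = leaf_bit w"
| "val (Suc t) v w = val t (target w) (items v ! index w)"

lemma finite_codes: "finite (arrays m t) \<and> finite (pointers m t)"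
  by (induction t) (auto intro: finite_lists_length_eq)

lemma card_arrays_Suc: "card (arrays m (Suc t)) = card (pointers m t) ^ m"
proof -
  have "card (arrays m (Suc t)) = card {xs. set xs \<subseteq> pointers m t \<and> length xs = m}"
    by (simp add: card_image inj_on_def)
  then show ?thesis
    using finite_codes by (simp add: card_lists_length_eq)
qed

lemma card_pointers_Suc: "card (pointers m (Suc t)) = m * card (arrays m t)"
proof -
  have "card (pointers m (Suc t)) = card ({..<m} \<times> arrays m t)"
    unfolding pointers.simps by (rule card_image) (auto simp: inj_on_def)
  then show ?thesis
    by (simp add: card_cartesian_product)
qed

lemma card_codes_pos: "0 < m \<Longrightarrow> 0 < card (arrays m t) \<and> 0 < card (pointers m t)"
  by (induction t) (auto simp: card_arrays_Suc card_pointers_Suc simp del: arrays.simps(2) pointers.simps(2))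

lemma arrays_SucD:
  "v \<in> arrays m (Suc t) \<Longrightarrow> v = Array (items v) \<and> set (items v) \<subseteq> pointers m t \<and> length (items v) = m"
  by auto

lemma card_items: "V \<subseteq> arrays m (Suc t) \<Longrightarrow> card (items ` V) = card V"
  by (intro card_image inj_onI) (metis arrays_SucD subsetD)

lemma card_pointer_pairs:
  assumes "W \<subseteq> pointers m (Suc t)"
  shows "card {(i, y). Pointer i y \<in> W} = card W"
proof -
  have "W = (\<lambda>(i, y). Pointer i y) ` {(i, y). Pointer i y \<in> W}"
    using assms by (auto simp: image_iff)
  moreover have "inj_on (\<lambda>(i, y). Pointer i y) {(i, y). Pointer i y \<in> W}"
    by (auto simp: inj_on_def)
  ultimately show ?thesis
    by (metis card_image)
qed

section \<open>Restricting to a subtree\<close>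

text \<open>A list in \<open>A\<close> is determined by its coordinates, so \<open>A\<close> embeds
  in the product of its projections. Restricting the index function to \<open>{..<m}\<close> makes
  it extensional, as \<open>PiE\<close> requires.\<close>

lemma card_le_prod_projections:
  assumes S: "finite S" and A: "A \<subseteq> {xs. set xs \<subseteq> S \<and> length xs = m}"
  shows "card A \<le> (\<Prod>i<m. card ((\<lambda>xs. xs ! i) ` A))"
proof -
  let ?h = "\<lambda>xs. restrict (\<lambda>i. xs ! i) {..<m}"
  have fA: "finite A"
    using A S finite_lists_length_eq finite_subset by blast
  have "inj_on ?h A"
  proof (rule inj_onI)
    fix xs ys assume xy: "xs \<in> A" "ys \<in> A" "?h xs = ?h ys"
    then have "xs ! i = ys ! i" if "i < m" for i
      using that by (metis lessThan_iff restrict_apply')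
    with xy A show "xs = ys"
      by (intro nth_equalityI) auto
  qed
  moreover have "?h ` A \<subseteq> PiE {..<m} (\<lambda>i. (\<lambda>xs. xs ! i) ` A)"
    by (intro image_subsetI PiE_I) auto
  moreover have "finite (PiE {..<m} (\<lambda>i. (\<lambda>xs. xs ! i) ` A))"
    using fA by (intro finite_PiE) auto
  ultimately have "card A \<le> card (PiE {..<m} (\<lambda>i. (\<lambda>xs. xs ! i) ` A))"
    by (rule card_inj_on_le)
  then show ?thesis
    by (simp add: card_PiE)
qed

lemma card_eq_sum_fibres:
  assumes "B \<subseteq> {..<m::nat} \<times> Y" "finite Y"
  shows "card B = (\<Sum>i<m. card {y. (i, y) \<in> B})"
proof -
  have "B = Sigma {..<m} (\<lambda>i. {y. (i, y) \<in> B})"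
    using assms(1) by auto
  moreover have "finite {y. (i, y) \<in> B}" for i
    using assms by (auto intro: finite_subset[of _ Y])
  ultimately show ?thesis
    by (metis card_SigmaI finite_lessThan)
qed

text \<open>The density of \<open>A\<close> allows fewer than \<open>k\<close> of the
  \<open>8 * k\<close> coordinates to have a small projection. These carry less than an eighth of
  all pairs, so some other coordinate has a fibre of density at least
  \<open>b - 1/8\<close>.\<close>

lemma large_projection_and_fibre:
  fixes b :: real
  assumes S: "finite S" and A: "A \<subseteq> {xs. set xs \<subseteq> S \<and> length xs = 8 * k}"
    and dA: "(7/8) ^ k * card S ^ (8 * k) < card A"
    and Y: "finite Y" "Y \<noteq> {}" and B: "B \<subseteq> {..<8 * k} \<times> Y"
    and dB: "b * (8 * k * card Y) \<le> card B" and b: "1/8 \<le> b" and k: "0 < k"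
  shows "\<exists>i<8 * k. 7/8 * card S \<le> card ((\<lambda>xs. xs ! i) ` A) \<and> (b - 1/8) * card Y \<le> card {y. (i, y) \<in> B}"
proof (rule ccontr)
  assume contra: "\<not> ?thesis"
  define p where "p i = card ((\<lambda>xs. xs ! i) ` A)" for i
  define r where "r i = card {y. (i, y) \<in> B}" for i
  \<comment> \<open>Every bad coordinate contributes a factor 7/8 to the product bound on
    \<open>card A\<close>.\<close>
  define bad where "bad = {i\<in>{..<8*k}. p i < 7/8 * card S}"
  have bad_sub: "bad \<subseteq> {..<8*k}" and [simp]: "finite bad"
    by (auto simp: bad_def)
  have p_le: "p i \<le> card S" if "i < 8 * k" for i
    unfolding p_def using A that by (intro card_mono S) (force simp: set_conv_nth)
  have r_le: "r i \<le> card Y" for i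
    unfolding r_def using B by (intro card_mono Y) auto
  have "real (card A) \<le> (\<Prod>i<8*k. real (p i))"
    using card_le_prod_projections[OF S A] unfolding p_def by (metis of_nat_le_iff of_nat_prod)
  also have "\<dots> \<le> (\<Prod>i<8*k. (if i \<in> bad then 7/8 else 1) * card S)"
    using p_le by (intro prod_mono) (auto simp: bad_def)
  also have "\<dots> = (7/8) ^ card bad * card S ^ (8 * k)"
    using bad_sub by (simp add: prod.distrib prod.If_cases Int_absorb1)
  finally have "(7/8 :: real) ^ k * card S ^ (8 * k) < (7/8) ^ card bad * card S ^ (8 * k)"
    using dA by linarith
  then have "(7/8 :: real) ^ k < (7/8) ^ card bad"
    by (meson mult_right_mono not_le of_nat_0_le_iff zero_le_power)
  then have bad_lt: "card bad < k"
    using power_decreasing[of k "card bad" "7/8 :: real"] by fastforce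
  have good: "r i \<le> (b - 1/8) * card Y" if "i \<in> {..<8*k} - bad" for i
    using contra that unfolding p_def r_def bad_def by fastforce
  have "real (card B) = (\<Sum>i<8*k. real (r i))"
    using card_eq_sum_fibres[OF B Y(1)] by (simp add: r_def)
  also have "\<dots> = (\<Sum>i\<in>bad. real (r i)) + (\<Sum>i\<in>{..<8*k} - bad. real (r i))"
    using sum.subset_diff[OF bad_sub, of "\<lambda>i. real (r i)"] by simp
  also have "(\<Sum>i\<in>bad. real (r i)) \<le> card bad * card Y"
    using sum_bounded_above[of bad "\<lambda>i. real (r i)" "card Y"] r_le by simp
  also have "(\<Sum>i\<in>{..<8*k} - bad. real (r i)) \<le> card ({..<8*k} - bad) * ((b - 1/8) * card Y)"
    by (rule sum_bounded_above[OF good])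
  \<comment> \<open>Counting all coordinates instead of the good ones only enlarges the bound,
    because \<open>1/8 \<le> b\<close>.\<close>
  also have "\<dots> \<le> 8 * k * ((b - 1/8) * card Y)"
  proof (intro mult_right_mono)
    show "real (card ({..<8*k} - bad)) \<le> real (8 * k)"
      using card_mono[of "{..<8*k}" "{..<8*k} - bad"] by simp
  qed (use b in auto)
  finally have "real (card B) \<le> card bad * card Y + 8 * k * ((b - 1/8) * card Y)"
    by simp
  moreover have "real (card bad) * card Y < k * card Y"
    using bad_lt Y by (simp add: card_gt_0_iff)
  ultimately show False
    using dB by (simp add: algebra_simps)
qed

section \<open>Dense copies of the game and descent by one level\<close>

text \<open>The relation \<open>R\<close> on \<open>X \<times> Y\<close> contains a copy of the depth-\<open>t\<close> game restricted to a set of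
  arrays of density \<open>a\<close> and a set of pointers of density \<open>b\<close>.\<close>
definition embeds ::
  "nat \<Rightarrow> nat \<Rightarrow> real \<Rightarrow> real \<Rightarrow> ('x \<Rightarrow> 'y \<Rightarrow> bool) \<Rightarrow> 'x set \<Rightarrow> 'y set \<Rightarrow> bool" where
  "embeds m t a b R X Y \<longleftrightarrow> (\<exists>V W f g. V \<subseteq> arrays m t \<and> W \<subseteq> pointers m t \<and>
     a * card (arrays m t) \<le> card V \<and> b * card (pointers m t) \<le> card W \<and>
     f ` V \<subseteq> X \<and> g ` W \<subseteq> Y \<and> (\<forall>v\<in>V. \<forall>w\<in>W. R (f v) (g w) = val t v w))"

lemma embedsE:
  assumes "embeds m t a b R X Y"
  obtains V W f g where "V \<subseteq> arrays m t" "W \<subseteq> pointers m t"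
    "a * card (arrays m t) \<le> card V" "b * card (pointers m t) \<le> card W"
    "f ` V \<subseteq> X" "g ` W \<subseteq> Y" "\<forall>v\<in>V. \<forall>w\<in>W. R (f v) (g w) = val t v w"
  using assms unfolding embeds_def by (elim exE conjE) (rule that)

text \<open>Once the index \<open>i\<close> is fixed, the value depends only on coordinate
  \<open>i\<close> of the array and on the target. The players exchange roles, hence the transposed
  relation.\<close>

lemma embeds_subtree:
  fixes a b :: real
  assumes V: "V \<subseteq> arrays m (Suc t)" and W: "W \<subseteq> pointers m (Suc t)"
    and fg: "f ` V \<subseteq> X" "g ` W \<subseteq> Y" "\<forall>v\<in>V. \<forall>w\<in>W. R (f v) (g w) = val (Suc t) v w"
    and i: "i < m"
    and a: "a * card (arrays m t) \<le> card {y. Pointer i y \<in> W}"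
    and b: "b * card (pointers m t) \<le> card ((\<lambda>v. items v ! i) ` V)"
  shows "embeds m t a b (\<lambda>y x. R x y) Y X"
proof -
  \<comment> \<open>For each value of coordinate \<open>i\<close>, one array in \<open>V\<close>
    attaining it is chosen; its other entries do not affect the value.\<close>
  define h where "h = inv_into V (\<lambda>v. items v ! i)"
  have h: "h x \<in> V" "items (h x) ! i = x" if "x \<in> (\<lambda>v. items v ! i) ` V" for x
    using that unfolding h_def by (simp_all add: inv_into_into f_inv_into_f[of x "\<lambda>v. items v ! i"])
  show ?thesis
    unfolding embeds_def
  proof (intro exI conjI)
    show "{y. Pointer i y \<in> W} \<subseteq> arrays m t"
      using W by auto
    show "(\<lambda>v. items v ! i) ` V \<subseteq> pointers m t"
      using V i by (force simp: set_conv_nth)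
    show "(\<lambda>y. g (Pointer i y)) ` {y. Pointer i y \<in> W} \<subseteq> Y"
      using fg by auto
    show "(\<lambda>x. f (h x)) ` (\<lambda>v. items v ! i) ` V \<subseteq> X"
      using fg h by blast
    show "\<forall>y\<in>{y. Pointer i y \<in> W}. \<forall>x\<in>(\<lambda>v. items v ! i) ` V. R (f (h x)) (g (Pointer i y)) = val t y x"
      using fg(3) h by (metis (no_types, lifting) code.sel mem_Collect_eq val.simps(2))
  qed (use a b in auto)
qed

text \<open>The array side is reset to density 7/8 however small \<open>a\<close> was, as long as it
  exceeds \<open>(7/8) ^ k\<close>. The price is 1/8 of the density on the pointer side.\<close>

lemma embeds_descend:
  assumes e: "embeds (8 * k) (Suc t) a b R X Y" and a: "(7/8) ^ k < a" and b: "1/8 \<le> b" and k: "0 < k"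
  shows "embeds (8 * k) t (b - 1/8) (7/8) (\<lambda>y x. R x y) Y X"
proof -
  let ?m = "8 * k"
  obtain V W f g where V: "V \<subseteq> arrays ?m (Suc t)" and W: "W \<subseteq> pointers ?m (Suc t)"
    and cV: "a * card (arrays ?m (Suc t)) \<le> card V" and cW: "b * card (pointers ?m (Suc t)) \<le> card W"
    and fg: "f ` V \<subseteq> X" "g ` W \<subseteq> Y" "\<forall>v\<in>V. \<forall>w\<in>W. R (f v) (g w) = val (Suc t) v w"
    using e by (rule embedsE)
  define A where "A = items ` V"
  define B where "B = {(i, y). Pointer i y \<in> W}"
  have cA: "card A = card V"
    unfolding A_def by (rule card_items[OF V])
  have cB: "card B = card W"
    unfolding B_def by (rule card_pointer_pairs[OF W])
  have pos: "0 < card (arrays ?m t)" "0 < card (pointers ?m t)"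
    using card_codes_pos[of ?m t] k by auto
  have "\<exists>i<?m. 7/8 * card (pointers ?m t) \<le> card ((\<lambda>xs. xs ! i) ` A) \<and>
      (b - 1/8) * card (arrays ?m t) \<le> card {y. (i, y) \<in> B}"
  proof (rule large_projection_and_fibre)
    show "A \<subseteq> {xs. set xs \<subseteq> pointers ?m t \<and> length xs = ?m}"
      using V arrays_SucD unfolding A_def by blast
    have "(7/8) ^ k * real (card (pointers ?m t)) ^ ?m < a * real (card (pointers ?m t)) ^ ?m"
      using a pos by (intro mult_strict_right_mono) auto
    also have "\<dots> \<le> card A"
      using cV unfolding cA card_arrays_Suc by simp
    finally show "(7/8) ^ k * card (pointers ?m t) ^ ?m < real (card A)"
      by simp
    show "B \<subseteq> {..<?m} \<times> arrays ?m t"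
      using W by (auto simp: B_def)
    show "b * (8 * k * card (arrays ?m t)) \<le> card B"
      using cW unfolding cB card_pointers_Suc by simp
  qed (use finite_codes pos b k in auto)
  then obtain i where "i < ?m" "7/8 * card (pointers ?m t) \<le> card ((\<lambda>xs. xs ! i) ` A)"
    "(b - 1/8) * card (arrays ?m t) \<le> card {y. (i, y) \<in> B}"
    by blast
  then show ?thesis
    using embeds_subtree[OF V W fg] by (simp add: A_def B_def image_image)
qed

text \<open>This descent restores no density but loses none either, and needs no lower bound on
  \<open>a\<close> or \<open>b\<close>. Averaging over the indices finds a fibre of density
  \<open>b\<close>, and every projection of the arrays has density at least
  \<open>a\<close>.\<close>

lemma embeds_skip:
  assumes e: "embeds m (Suc t) a b R X Y" and m: "0 < m"
  shows "embeds m t b a (\<lambda>y x. R x y) Y X"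
proof -
  obtain V W f g where V: "V \<subseteq> arrays m (Suc t)" and W: "W \<subseteq> pointers m (Suc t)"
    and cV: "a * card (arrays m (Suc t)) \<le> card V" and cW: "b * card (pointers m (Suc t)) \<le> card W"
    and fg: "f ` V \<subseteq> X" "g ` W \<subseteq> Y" "\<forall>v\<in>V. \<forall>w\<in>W. R (f v) (g w) = val (Suc t) v w"
    using e by (rule embedsE)
  define A where "A = items ` V"
  define B where "B = {(i, y). Pointer i y \<in> W}"
  have A: "A \<subseteq> {xs. set xs \<subseteq> pointers m t \<and> length xs = m}"
    using V arrays_SucD unfolding A_def by blast
  have B: "B \<subseteq> {..<m} \<times> arrays m t"
    using W by (auto simp: B_def)
  have cA: "card A = card V"
    unfolding A_def by (rule card_items[OF V])
  have cB: "card B = card W"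
    unfolding B_def by (rule card_pointer_pairs[OF W])
  have pos: "0 < card (arrays m t)" "0 < card (pointers m t)"
    using card_codes_pos[of m t] m by auto
  have fin: "finite (arrays m t)" "finite (pointers m t)"
    using finite_codes by auto
  have "\<exists>i<m. b * card (arrays m t) \<le> card {y. (i, y) \<in> B}"
  proof (rule ccontr)
    assume "\<not> ?thesis"
    then have "(\<Sum>i<m. real (card {y. (i, y) \<in> B})) < (\<Sum>i<m. b * card (arrays m t))"
      using m by (intro sum_strict_mono) (auto simp: not_le)
    then have "real (card B) < m * (b * card (arrays m t))"
      using card_eq_sum_fibres[OF B fin(1)] by simp
    then show False
      using cW unfolding cB card_pointers_Suc by (simp add: algebra_simps)
  qed
  then obtain i where i: "i < m" "b * card (arrays m t) \<le> card {y. (i, y) \<in> B}"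
    by blast
  let ?p = "\<lambda>j. card ((\<lambda>xs. xs ! j) ` A)" and ?N = "card (pointers m t)"
  have p_le: "?p j \<le> ?N" if "j < m" for j
    using A that by (intro card_mono fin) (force simp: set_conv_nth)
  have "card A \<le> (\<Prod>j<m. ?p j)"
    by (rule card_le_prod_projections[OF fin(2) A])
  also have "\<dots> = ?p i * (\<Prod>j\<in>{..<m} - {i}. ?p j)"
    using i by (simp add: prod.remove)
  \<comment> \<open>All coordinates other than \<open>i\<close> are bounded by their full size, so
    the whole deficit is charged to coordinate \<open>i\<close>.\<close>
  also have "\<dots> \<le> ?p i * (\<Prod>j\<in>{..<m} - {i}. ?N)"
    using p_le by (intro mult_left_mono prod_mono) auto
  also have "\<dots> = ?p i * ?N ^ (m - 1)"
    using i by simp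
  finally have "real (card A) \<le> ?p i * ?N ^ (m - 1)"
    by (metis of_nat_le_iff of_nat_mult)
  moreover have "?N ^ m = ?N * ?N ^ (m - 1)"
    using m by (metis power_eq_if neq0_conv)
  ultimately have "(a * ?N) * ?N ^ (m - 1) \<le> ?p i * real (?N ^ (m - 1))"
    using cV unfolding cA card_arrays_Suc by (simp add: mult.assoc)
  then have "a * ?N \<le> ?p i"
    using pos by simp
  with i show ?thesis
    using embeds_subtree[OF V W fg] by (simp add: A_def B_def image_image)
qed

section \<open>Loss of density through one message\<close>

lemma large_colour_class:
  assumes "finite C" "card C \<le> q" "c ` V \<subseteq> C" "finite V" "0 < q"
  shows "\<exists>z. card V / q \<le> card {v\<in>V. c v = z}"
proof (rule ccontr)
  assume "\<not> ?thesis"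
  then have lt: "real (card {v\<in>V. c v = z}) < card V / q" for z
    by (simp add: not_le)
  then have "V \<noteq> {}"
    by fastforce
  then have "C \<noteq> {}"
    using assms by auto
  have "V = (\<Union>z\<in>C. {v\<in>V. c v = z})"
    using assms by auto
  then have "card V = (\<Sum>z\<in>C. card {v\<in>V. c v = z})"
    using assms by (subst card_UN_disjoint[symmetric]) auto
  then have "real (card V) = (\<Sum>z\<in>C. real (card {v\<in>V. c v = z}))"
    by simp
  also have "\<dots> < (\<Sum>z\<in>C. card V / q)"
    using assms lt \<open>C \<noteq> {}\<close> by (intro sum_strict_mono) auto
  also have "\<dots> = card C * (card V / q)"
    by simp
  also have "\<dots> \<le> q * (card V / q)"
    using assms by (intro mult_right_mono) auto
  finally show False
    using assms by simp
qed

text \<open>The colour \<open>c\<close> stands for the message of the player holding the arrays: the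
  most frequent of at most \<open>q\<close> messages keeps a \<open>1/q\<close> share, and the other
  side is untouched.\<close>

lemma embeds_restrict_array:
  assumes e: "embeds m t a b R X Y" and C: "finite C" "card C \<le> q" "c ` X \<subseteq> C" "0 < q"
  shows "\<exists>z. embeds m t (a / q) b R {x\<in>X. c x = z} Y"
proof -
  obtain V W f g where V: "V \<subseteq> arrays m t" and W: "W \<subseteq> pointers m t"
    and cV: "a * card (arrays m t) \<le> card V" and cW: "b * card (pointers m t) \<le> card W"
    and fg: "f ` V \<subseteq> X" "g ` W \<subseteq> Y" "\<forall>v\<in>V. \<forall>w\<in>W. R (f v) (g w) = val t v w"
    using e by (rule embedsE)
  have "finite V"
    using V finite_codes finite_subset by blast
  then obtain z where z: "card V / q \<le> card {v\<in>V. c (f v) = z}"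
    using large_colour_class[of C q "\<lambda>v. c (f v)" V] C fg(1) by blast
  have "a / q * card (arrays m t) \<le> card V / q"
    using divide_right_mono[OF cV, of q] by simp
  with z have "a / q * card (arrays m t) \<le> card {v\<in>V. c (f v) = z}"
    by linarith
  then have "embeds m t (a / q) b R {x\<in>X. c x = z} Y"
    unfolding embeds_def using V W cW fg
    by (intro exI[of _ "{v\<in>V. c (f v) = z}"] exI[of _ W] exI[of _ f] exI[of _ g]) auto
  then show ?thesis ..
qed

lemma embeds_restrict_pointer:
  assumes e: "embeds m t a b R X Y" and C: "finite C" "card C \<le> q" "c ` Y \<subseteq> C" "0 < q"
  shows "\<exists>z. embeds m t a (b / q) R X {y\<in>Y. c y = z}"
proof -
  obtain V W f g where V: "V \<subseteq> arrays m t" and W: "W \<subseteq> pointers m t"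
    and cV: "a * card (arrays m t) \<le> card V" and cW: "b * card (pointers m t) \<le> card W"
    and fg: "f ` V \<subseteq> X" "g ` W \<subseteq> Y" "\<forall>v\<in>V. \<forall>w\<in>W. R (f v) (g w) = val t v w"
    using e by (rule embedsE)
  have "finite W"
    using W finite_codes finite_subset by blast
  then obtain z where z: "card W / q \<le> card {v\<in>W. c (g v) = z}"
    using large_colour_class[of C q "\<lambda>v. c (g v)" W] C fg(2) by blast
  have "b / q * card (pointers m t) \<le> card W / q"
    using divide_right_mono[OF cW, of q] by simp
  with z have "b / q * card (pointers m t) \<le> card {v\<in>W. c (g v) = z}"
    by linarith
  then have "embeds m t a (b / q) R X {y\<in>Y. c y = z}"
    unfolding embeds_def using V W cV fg
    by (intro exI[of _ V] exI[of _ "{v\<in>W. c (g v) = z}"] exI[of _ f] exI[of _ g]) auto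
  then show ?thesis ..
qed

text \<open>More than half of the two leaves means both of them.\<close>

lemma embeds_0_both_values:
  assumes e: "embeds m 0 a b R X Y" and ab: "0 < a" "1/2 < b"
  shows "\<exists>x\<in>X. \<exists>y\<in>Y. R x y = s"
proof -
  obtain V W f g where V: "V \<subseteq> arrays m 0" and W: "W \<subseteq> pointers m 0"
    and cV: "a * card (arrays m 0) \<le> card V" and cW: "b * card (pointers m 0) \<le> card W"
    and fg: "f ` V \<subseteq> X" "g ` W \<subseteq> Y" "\<forall>v\<in>V. \<forall>w\<in>W. R (f v) (g w) = val 0 v w"
    using e by (rule embedsE)
  have fW: "finite W"
    using W finite_subset by fastforce
  have "real (card W) > 1"
    using cW ab by simp
  then have W2: "W = {Leaf True, Leaf False}"
    using W card_seteq[of "{Leaf True, Leaf False}" W] by simp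
  obtain v where "v \<in> V"
    using cV ab by fastforce
  moreover have "Leaf s \<in> W"
    using W2 by (cases s) auto
  ultimately have "R (f v) (g (Leaf s)) = s" "f v \<in> X" "g (Leaf s) \<in> Y"
    using fg by auto
  then show ?thesis by blast
qed

text \<open>Three levels pay for one message, whoever sends it: passing a level at which the sender holds
  the arrays restores the sender's density.\<close>
abbreviation hard :: "nat \<Rightarrow> nat \<Rightarrow> ('x \<Rightarrow> 'y \<Rightarrow> bool) \<Rightarrow> 'x set \<Rightarrow> 'y set \<Rightarrow> bool" where
  "hard m t \<equiv> embeds m t (3/4) (7/8)"

text \<open>The pair (3/4, 7/8) is a fixed point of \<open>embeds_descend\<close>, since 7/8 - 1/8 =
  3/4.\<close>

lemma hard_descend:
  assumes "hard (8 * k) (Suc t) R X Y" "0 < k" "(7/8) ^ k < (3/4 :: real)"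
  shows "hard (8 * k) t (\<lambda>y x. R x y) Y X"
  using embeds_descend[OF assms(1,3) _ assms(2)] by simp

lemma hard_restrict_array:
  assumes h: "hard (8 * k) (t + 3) R X Y" and C: "finite C" "card C \<le> q" "c ` X \<subseteq> C" "0 < q"
    and k: "0 < k" "(7/8) ^ k < 1 / (2 * real q)"
  shows "\<exists>z. hard (8 * k) t (\<lambda>y x. R x y) Y {x\<in>X. c x = z}"
proof -
  obtain z where z: "embeds (8 * k) (Suc (Suc (Suc t))) (3/4 / q) (7/8) R {x\<in>X. c x = z} Y"
    using embeds_restrict_array[OF h C] by (auto simp: numeral_3_eq_3)
  \<comment> \<open>The single hypothesis on \<open>k\<close> meets the density threshold of all
    three descents.\<close>
  have "1 / (2 * real q) \<le> 3/4 / q" "1 / (2 * real q) \<le> 1/2"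
    using C by (auto simp: field_simps)
  with k have a: "(7/8) ^ k < 3/4 / real q" and a': "(7/8) ^ k < (3/4 :: real)"
    by linarith+
  \<comment> \<open>The first descent already repairs the sender's density. The remaining two only
    make the cost equal to that of a message from the pointer side.\<close>
  have "hard (8 * k) (Suc (Suc t)) (\<lambda>y x. R x y) Y {x\<in>X. c x = z}"
    using embeds_descend[OF z a _ k(1)] by simp
  from hard_descend[OF hard_descend[OF this k(1) a'] k(1) a'] show ?thesis
    by blast
qed

lemma hard_restrict_pointer:
  assumes h: "hard (8 * k) (t + 3) R X Y" and C: "finite C" "card C \<le> q" "c ` Y \<subseteq> C" "0 < q"
    and k: "0 < k" "(7/8) ^ k < 1 / (2 * real q)"
  shows "\<exists>z. hard (8 * k) t (\<lambda>y x. R x y) {y\<in>Y. c y = z} X"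
proof -
  obtain z where z: "embeds (8 * k) (Suc (Suc (Suc t))) (3/4) (7/8 / q) R X {y\<in>Y. c y = z}"
    using embeds_restrict_pointer[OF h C] by (auto simp: numeral_3_eq_3)
  have "1 / (2 * real q) \<le> 7/8 / q" "1 / (2 * real q) \<le> 1/2"
    using C by (auto simp: field_simps)
  with k have a: "(7/8) ^ k < 7/8 / real q" and a': "(7/8) ^ k < (5/8 :: real)"
    by linarith+
  \<comment> \<open>A density of \<open>7/8 / q\<close> may be below the 1/8 that
    \<open>embeds_descend\<close> needs on the pointer side. The skip first makes the sender the
    array holder; the next descent raises it to 7/8 and lowers the other side from 3/4 to 5/8, and
    the last one restores both.\<close>
  have "embeds (8 * k) (Suc (Suc t)) (7/8 / q) (3/4) (\<lambda>y x. R x y) {y\<in>Y. c y = z} X"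
    using embeds_skip[OF z] k by simp
  from embeds_descend[OF this a _ k(1)]
  have "embeds (8 * k) (Suc t) (5/8) (7/8) R X {y\<in>Y. c y = z}"
    by simp
  from embeds_descend[OF this a' _ k(1)] show ?thesis
    by auto
qed

section \<open>Protocols on the tree game\<close>

text \<open>Induction on the number of messages: each one shrinks the rectangle to inputs that agree
  on it and uses three levels. Either player may hold the arrays of the remaining game, hence the
  disjunction.\<close>

lemma run_transcript_on_hard_rectangle:
  fixes inA :: "'x \<Rightarrow> sample" and inB :: "'y \<Rightarrow> sample"
  assumes h: "hard (8 * k) (3 * d) R X0 Y0"
    and C: "finite C" "card C \<le> q" "0 < q"
    and msgs: "\<And>x t. x \<in> X0 \<Longrightarrow> alice_msg P (inA x) t \<in> C" "\<And>y t. y \<in> Y0 \<Longrightarrow> bob_msg P (inB y) t \<in> C"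
    and k: "0 < k" "(7/8) ^ k < 1 / (2 * real q)"
    and j: "j \<le> d"
  shows "\<exists>X Y \<tau>. X \<subseteq> X0 \<and> Y \<subseteq> Y0 \<and> (\<forall>x\<in>X. \<forall>y\<in>Y. run P (inA x) (inB y) j = \<tau>) \<and>
    (hard (8 * k) (3 * (d - j)) R X Y \<or> hard (8 * k) (3 * (d - j)) (\<lambda>y x. R x y) Y X)"
  using j
proof (induction j)
  case 0
  then show ?case
    using h by (intro exI[of _ X0] exI[of _ Y0] exI[of _ "[]"]) simp
next
  case (Suc j)
  then obtain X Y \<tau> where XY: "X \<subseteq> X0" "Y \<subseteq> Y0" and run: "\<forall>x\<in>X. \<forall>y\<in>Y. run P (inA x) (inB y) j = \<tau>"
    and hd: "hard (8 * k) (3 * (d - j)) R X Y \<or> hard (8 * k) (3 * (d - j)) (\<lambda>y x. R x y) Y X"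
    by auto
  let ?t = "3 * (d - Suc j)"
  have t: "3 * (d - j) = ?t + 3"
    using Suc.prems by simp
  let ?goal = "\<lambda>X' Y'. hard (8 * k) ?t R X' Y' \<or> hard (8 * k) ?t (\<lambda>y x. R x y) Y' X'"
  have A: "\<exists>z. ?goal {x\<in>X. c x = z} Y" if "c ` X \<subseteq> C" for c
    using hd unfolding t
    using hard_restrict_array[OF _ C(1,2) that C(3) k, of ?t R Y]
      hard_restrict_pointer[OF _ C(1,2) that C(3) k, of ?t "\<lambda>y x. R x y" Y] by blast
  have B: "\<exists>z. ?goal X {y\<in>Y. c y = z}" if "c ` Y \<subseteq> C" for c
    using hd unfolding t
    using hard_restrict_array[OF _ C(1,2) that C(3) k, of ?t "\<lambda>y x. R x y" X]
      hard_restrict_pointer[OF _ C(1,2) that C(3) k, of ?t R X] by blast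
  show ?case
  proof (cases "speaker P \<tau>")
    case None
    \<comment> \<open>After halting no message is sent, but the level count must still drop by
      three; a constant colouring achieves this.\<close>
    obtain c0 where "c0 \<in> C \<or> X = {}"
      using msgs XY by blast
    then obtain z where "?goal {x\<in>X. c0 = z} Y"
      using A[of "\<lambda>_. c0"] by auto
    then show ?thesis
      using XY run None
      by (intro exI[of _ "{x\<in>X. c0 = z}"] exI[of _ Y] exI[of _ \<tau>]) (auto simp: Let_def)
  next
    case (Some p)
    show ?thesis
    proof (cases p)
      case Alice
      obtain z where "?goal {x\<in>X. alice_msg P (inA x) \<tau> = z} Y"
        using A[of "\<lambda>x. alice_msg P (inA x) \<tau>"] msgs XY by blast
      then show ?thesis
        using XY run Some Alice
        by (intro exI[of _ "{x\<in>X. alice_msg P (inA x) \<tau> = z}"] exI[of _ Y] exI[of _ "\<tau> @ [z]"])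
          (auto simp: Let_def)
    next
      case Bob
      obtain z where "?goal X {y\<in>Y. bob_msg P (inB y) \<tau> = z}"
        using B[of "\<lambda>y. bob_msg P (inB y) \<tau>"] msgs XY by blast
      then show ?thesis
        using XY run Some Bob
        by (intro exI[of _ X] exI[of _ "{y\<in>Y. bob_msg P (inB y) \<tau> = z}"] exI[of _ "\<tau> @ [z]"])
          (auto simp: Let_def)
    qed
  qed
qed

section \<open>Realising the tree game in the plane\<close>

text \<open>Up to the reflection in the second coordinate, which exchanges the two players, this is the
  affine map preserving the parabola \<open>y = - x^2\<close> and contracting the plane towards its point
  \<open>(i, - i^2)\<close>.\<close>
definition place :: "nat \<Rightarrow> nat \<Rightarrow> real \<times> real \<Rightarrow> real \<times> real" where
  "place m i = (\<lambda>(x, y). let e = 1 / (8 * real m ^ 2) in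
     (i + e * x, - (real i ^ 2) - 2 * i * e * x - e ^ 2 * y))"

text \<open>Array points are to lie below a separating line and pointer points above it. The bit
  decides whether the two depth-0 points differ or coincide; the exchange of roles at each level
  agrees with the reflection in \<open>place\<close>.\<close>

fun array_points :: "nat \<Rightarrow> nat \<Rightarrow> code \<Rightarrow> (real \<times> real) set"
  and pointer_points :: "nat \<Rightarrow> nat \<Rightarrow> code \<Rightarrow> (real \<times> real) set" where
  "array_points m 0 c = {(0, 0)}"
| "pointer_points m 0 c = {(0, if leaf_bit c then 1 else 0)}"
| "array_points m (Suc t) c = (\<Union>i<m. place m i ` pointer_points m t (items c ! i))"
| "pointer_points m (Suc t) c = place m (index c) ` array_points m t (target c)"

primrec all_points :: "nat \<Rightarrow> nat \<Rightarrow> (real \<times> real) set" where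
  "all_points m 0 = {(0, 0), (0, 1)}"
| "all_points m (Suc t) = (\<Union>i<m. place m i ` all_points m t)"

section \<open>Number, size and separation of the points\<close>

lemma points_subset:
  "(v \<in> arrays m t \<longrightarrow> array_points m t v \<subseteq> all_points m t) \<and>
   (w \<in> pointers m t \<longrightarrow> pointer_points m t w \<subseteq> all_points m t)"
proof (induction t arbitrary: v w)
  case (Suc t)
  have "array_points m (Suc t) v \<subseteq> all_points m (Suc t)" if v: "v \<in> arrays m (Suc t)"
  proof -
    have "items v ! i \<in> pointers m t" if "i < m" for i
      using v that by (force simp: set_conv_nth)
    then show ?thesis
      using Suc by fastforce
  qed
  moreover have "pointer_points m (Suc t) w \<subseteq> all_points m (Suc t)" if "w \<in> pointers m (Suc t)"
    using that Suc by fastforce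
  ultimately show ?case by blast
qed auto

text \<open>Padding a sample to a prescribed length repeats one of its examples, so each player
  needs at least one.\<close>

lemma points_nonempty:
  "0 < m \<Longrightarrow> array_points m t v \<noteq> {} \<and> pointer_points m t w \<noteq> {}"
proof (induction t arbitrary: v w)
  case (Suc t)
  then show ?case by (auto simp: lessThan_empty_iff)
qed auto

lemma finite_all_points: "finite (all_points m t)"
  by (induction t) auto

lemma card_all_points: "card (all_points m t) \<le> 2 * m ^ t"
proof (induction t)
  case (Suc t)
  have "card (all_points m (Suc t)) \<le> (\<Sum>i<m. card (place m i ` all_points m t))"
    by (simp add: card_UN_le)
  also have "\<dots> \<le> (\<Sum>i<m. 2 * m ^ t)"
    using Suc by (intro sum_mono le_trans[OF card_image_le[OF finite_all_points]])
  finally show ?case by simp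
qed simp

text \<open>The bound does not depend on the depth. With the scale
  \<open>1 / (8 * real m ^ 2)\<close> it keeps scaled coordinates within 1/8.\<close>

lemma all_points_bounded:
  assumes m: "0 < m" and p: "(x, y) \<in> all_points m t"
  shows "\<bar>x\<bar> \<le> real m ^ 2 \<and> \<bar>y\<bar> \<le> real m ^ 2"
  using p
proof (induction t arbitrary: x y)
  case 0
  then show ?case using m by auto
next
  case (Suc t)
  define e where "e = 1 / (8 * real m ^ 2)"
  obtain i x' y' where i: "i < m" and p: "(x', y') \<in> all_points m t"
    and xy: "x = i + e * x'" "y = - (real i ^ 2) - 2 * i * (e * x') - e * (e * y')"
    using Suc.prems by (auto simp: place_def e_def Let_def power2_eq_square algebra_simps)
  have m1: "1 \<le> real m" and i1: "real i \<le> real m - 1"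
    using m i by linarith+
  have "1 \<le> real m ^ 2"
    using m1 by (rule one_le_power)
  then have "1 \<le> 8 * real m ^ 2"
    by linarith
  then have e: "0 < e" "e \<le> 1" "e * real m ^ 2 = 1/8"
    using m by (auto simp: e_def divide_simps)
  have small: "\<bar>e * z\<bar> \<le> 1/8" if "\<bar>z\<bar> \<le> real m ^ 2" for z
    using mult_left_mono[OF that, of e] e by (simp add: abs_mult)
  have x': "\<bar>e * x'\<bar> \<le> 1/8" and y': "\<bar>e * y'\<bar> \<le> 1/8"
    using Suc.IH[OF p] small by auto
  have y'': "\<bar>e * (e * y')\<bar> \<le> 1"
    using mult_mono[of e 1 "\<bar>e * y'\<bar>" 1] y' e by (simp add: abs_mult)
  have ix: "\<bar>2 * i * (e * x')\<bar> \<le> 2 * real i"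
    using mult_left_mono[of "\<bar>e * x'\<bar>" 1 "2 * real i"] x' by (simp add: abs_mult)
  have "real m \<le> real m ^ 2"
    using m1 by (simp add: power2_eq_square)
  then have "\<bar>x\<bar> \<le> real m ^ 2"
    using xy x' i1 by linarith
  \<comment> \<open>The three terms of \<open>y\<close> add up to at most
    \<open>i^2 + 2 i + 1\<close>, and \<open>i \<le> m - 1\<close>.\<close>
  moreover have "(real i + 1) ^ 2 \<le> real m ^ 2"
    using i1 by (intro power_mono) auto
  then have "real i ^ 2 + 2 * real i + 1 \<le> real m ^ 2"
    by (simp add: power2_eq_square algebra_simps)
  then have "\<bar>y\<bar> \<le> real m ^ 2"
    using xy y'' ix zero_le_power2[of "real i"] by linarith
  ultimately show ?case ..
qed

text \<open>A common point of the selected subgame is carried by \<open>place m i\<close> to a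
  common point of the whole game.\<close>

lemma contact_at_false:
  "v \<in> arrays m t \<Longrightarrow> w \<in> pointers m t \<Longrightarrow> \<not> val t v w \<Longrightarrow>
    array_points m t v \<inter> pointer_points m t w \<noteq> {}"
proof (induction t arbitrary: v w)
  case 0
  then show ?case by auto
next
  case (Suc t)
  obtain xs where v: "v = Array xs" "set xs \<subseteq> pointers m t" "length xs = m"
    using Suc.prems by auto
  obtain i y where w: "w = Pointer i y" "i < m" "y \<in> arrays m t"
    using Suc.prems by auto
  have "xs ! i \<in> pointers m t"
    using v w by auto
  then obtain p where "p \<in> array_points m t y" "p \<in> pointer_points m t (xs ! i)"
    using Suc v w by fastforce
  then have "place m i p \<in> array_points m (Suc t) v \<inter> pointer_points m (Suc t) w"
    using v w by auto
  then show ?case by blast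
qed

text \<open>The bounds on slope and intercept keep a line near the tangent of the parabola at
  \<open>(i, - i^2)\<close> above the clusters around the other \<open>(j, - j^2)\<close>.\<close>
lemma separated_at_true:
  assumes m: "0 < m"
  shows "v \<in> arrays m t \<Longrightarrow> w \<in> pointers m t \<Longrightarrow> val t v w \<Longrightarrow>
    \<exists>s c. \<bar>s\<bar> \<le> real m ^ 2 \<and> \<bar>c\<bar> \<le> real m ^ 2 \<and>
      (\<forall>(x, y)\<in>array_points m t v. y < s * x + c) \<and> (\<forall>(x, y)\<in>pointer_points m t w. s * x + c < y)"
proof (induction t arbitrary: v w)
  case 0
  have "1 \<le> real m ^ 2"
    using m by simp
  with 0 show ?case
    by (intro exI[of _ 0] exI[of _ "1/2"]) auto
next
  case (Suc t)
  define e where "e = 1 / (8 * real m ^ 2)"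
  have m1: "1 \<le> real m"
    using m by simp
  have e: "0 < e" "e \<le> 1/8" "e * real m ^ 2 = 1/8"
    using m m1 by (auto simp: e_def divide_simps)
  have small: "\<bar>e * z\<bar> \<le> 1/8" if "\<bar>z\<bar> \<le> real m ^ 2" for z
    using mult_left_mono[OF that, of e] e by (simp add: abs_mult)
  have small2: "\<bar>e * (e * z)\<bar> \<le> 1/64" if "\<bar>z\<bar> \<le> real m ^ 2" for z
    using mult_mono[of e "1/8" "\<bar>e * z\<bar>" "1/8"] small[OF that] e by (simp add: abs_mult)
  have place: "place m i (x, y) = (i + e * x, - (real i ^ 2) - 2 * i * (e * x) - e * (e * y))" for i x y
    by (simp add: place_def e_def Let_def power2_eq_square)
  obtain xs where v: "v = Array xs" "set xs \<subseteq> pointers m t" "length xs = m"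
    using Suc.prems by auto
  obtain i u where w: "w = Pointer i u" "i < m" "u \<in> arrays m t"
    using Suc.prems by auto
  have xs: "xs ! j \<in> pointers m t" if "j < m" for j
    using v that by auto
  obtain s c where s: "\<bar>s\<bar> \<le> real m ^ 2" and c: "\<bar>c\<bar> \<le> real m ^ 2"
    and below: "\<forall>(x, y)\<in>array_points m t u. y < s * x + c"
    and above: "\<forall>(x, y)\<in>pointer_points m t (xs ! i). s * x + c < y"
    using Suc.IH[OF w(3) xs[OF w(2)]] Suc.prems v w by auto
  have i1: "real i \<le> real m - 1"
    using w by linarith
  \<comment> \<open>\<open>s'\<close> and \<open>c'\<close> are the slope and intercept of the image
    of the line \<open>y = s * x + c\<close> under \<open>place m i\<close>.\<close>
  define s' where "s' = - 2 * i - e * s"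
  define c' where "c' = real i ^ 2 + i * (e * s) - e * (e * c)"
  \<comment> \<open>Over a point of cluster \<open>j\<close>, the line is compared with the tangent
    of the parabola at \<open>(j, - j^2)\<close>. For \<open>j = i\<close> the bracket is
    \<open>- e^2 * (s * x + c)\<close>; otherwise \<open>(j - i)^2\<close> dominates it.\<close>
  have line: "s' * (real j + e * x) + c' = - (real j ^ 2) - 2 * j * (e * x) +
      ((real j - i) ^ 2 + 2 * (real j - i) * (e * x) - (real j - i) * (e * s) - (e * s) * (e * x) - e * (e * c))" for j x
    unfolding s'_def c'_def by (simp add: power2_eq_square algebra_simps)
  have isq: "(real i + 1) ^ 2 \<le> real m ^ 2"
    using i1 by (intro power_mono) auto
  have "\<bar>s'\<bar> \<le> 2 * real i + 1"
    unfolding s'_def using small[OF s] by linarith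
  also have "\<dots> \<le> (real i + 1) ^ 2"
    by (simp add: power2_eq_square algebra_simps)
  finally have s'b: "\<bar>s'\<bar> \<le> real m ^ 2"
    using isq by linarith
  have "\<bar>i * (e * s)\<bar> \<le> real i"
    using mult_left_mono[of "\<bar>e * s\<bar>" 1 "real i"] small[OF s] by (simp add: abs_mult)
  then have "\<bar>c'\<bar> \<le> (real i) ^ 2 + i + 1"
    unfolding c'_def using small2[OF c] zero_le_power2[of "real i"] by linarith
  also have "\<dots> \<le> (real i + 1) ^ 2"
    by (simp add: power2_eq_square algebra_simps)
  finally have c'b: "\<bar>c'\<bar> \<le> real m ^ 2"
    using isq by linarith
  have pointer: "s' * X + c' < Y" if "(X, Y) \<in> pointer_points m (Suc t) w" for X Y
  proof -
    have "(X, Y) \<in> place m i ` array_points m t u"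
      using that w by simp
    then obtain x y where p: "(x, y) \<in> array_points m t u" "(X, Y) = place m i (x, y)"
      by (metis imageE surj_pair)
    have "y < s * x + c"
      using below p by auto
    then have "e * (e * y) < e * (e * (s * x + c))"
      using e by simp
    then show ?thesis
      using p(2) line[of i x] unfolding place by (simp add: algebra_simps)
  qed
  have array: "Y < s' * X + c'" if XY: "(X, Y) \<in> array_points m (Suc t) v" for X Y
  proof -
    obtain j where j: "j < m" and "(X, Y) \<in> place m j ` pointer_points m t (xs ! j)"
      using XY unfolding v(1) by auto
    then obtain x y where p: "(x, y) \<in> pointer_points m t (xs ! j)" "(X, Y) = place m j (x, y)"
      by (metis imageE surj_pair)
    show ?thesis
    proof (cases "j = i")
      case True
      have "s * x + c < y"
        using above p True by auto
      then have "e * (e * (s * x + c)) < e * (e * y)"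
        using e by simp
      then show ?thesis
        using p(2) line[of i x] unfolding place True by (simp add: algebra_simps)
    next
      case False
      define l where "l = \<bar>real j - i\<bar>"
      have l: "1 \<le> l"
        unfolding l_def using False by (auto simp: abs_if)
      have "(x, y) \<in> all_points m t"
        using p points_subset xs[OF j] by blast
      then have xy: "\<bar>x\<bar> \<le> real m ^ 2" "\<bar>y\<bar> \<le> real m ^ 2"
        using all_points_bounded[OF m] by blast+
      have lb: "\<bar>(real j - i) * z\<bar> \<le> l / 8" if "\<bar>z\<bar> \<le> 1/8" for z
        using mult_left_mono[OF that, of l] by (simp add: abs_mult l_def)
      have "\<bar>(e * s) * (e * x)\<bar> \<le> 1/64"
        using mult_mono[OF small[OF s] small[OF xy(1)]] by (simp add: abs_mult)
      moreover have "l \<le> (real j - i) ^ 2"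
        using mult_left_mono[OF l, of l] l by (simp add: l_def power2_eq_square)
      moreover note lb[OF small[OF s]] lb[OF small[OF xy(1)]] small2[OF c] small2[OF xy(2)] l
      \<comment> \<open>The terms linear in \<open>j - i\<close> cost at most \<open>3 l / 8\<close>
        and the other three at most 3/64, against \<open>l^2 \<ge> l \<ge> 1\<close>.\<close>
      ultimately have "0 < (real j - i) ^ 2 + 2 * ((real j - i) * (e * x)) - (real j - i) * (e * s)
          - (e * s) * (e * x) - e * (e * c) + e * (e * y)"
        by linarith
      then show ?thesis
        using p(2) line[of j x] unfolding place by (simp add: algebra_simps)
    qed
  qed
  show ?case
    using s'b c'b pointer array by - (rule exI[of _ s'], rule exI[of _ c'], auto simp del: array_points.simps pointer_points.simps)
qed

section \<open>Labelled samples and the reduction to protocols\<close>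

definition to_vec :: "real \<times> real \<Rightarrow> real ^ 2" where
  "to_vec p = vector [fst p, snd p]"

definition labelled :: "bool \<Rightarrow> (real \<times> real) set \<Rightarrow> example set" where
  "labelled l S = (\<lambda>p. (to_vec p, l)) ` S"

lemma realizable_labelled:
  assumes "set Sa = labelled False A" "set Sb = labelled True B"
    and "\<forall>(x, y)\<in>A. y < s * x + c" "\<forall>(x, y)\<in>B. s * x + c < y"
  shows "realizable_hp (Sa @ Sb)"
  unfolding realizable_hp_def
proof (intro exI)
  \<comment> \<open>This half-plane is the region on or above the line
    \<open>y = s * x + c\<close>.\<close>
  show "\<forall>(x, y)\<in>set (Sa @ Sb). halfplane (vector [- s, 1]) c x = y"
    using assms by (fastforce simp: labelled_def to_vec_def halfplane_def inner_vec_def sum_2)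
qed

lemma contradictory_labelled:
  assumes "set Sa = labelled False A" "set Sb = labelled True B" "A \<inter> B \<noteq> {}"
  shows "contradictory (Sa @ Sb)"
  using assms unfolding contradictory_def labelled_def by auto

text \<open>\<open>solves_within\<close> speaks only of inputs of total length exactly
  \<open>n\<close>, so samples are padded by repetition.\<close>

lemma finite_nonempty_list_of_length:
  assumes "finite A" "A \<noteq> {}" "card A \<le> n"
  shows "\<exists>xs. set xs = A \<and> length xs = n"
proof -
  obtain xs where xs: "set xs = A" "distinct xs"
    using assms finite_distinct_list by blast
  obtain a where "a \<in> A"
    using assms by blast
  then have "set (xs @ replicate (n - length xs) a) = A"
    using xs by auto
  moreover have "length (xs @ replicate (n - length xs) a) = n"
    using xs assms distinct_card by fastforce
  ultimately show ?thesis by blast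
qed

text \<open>Otherwise \<open>3 * d\<close> levels fit into samples of total size \<open>n\<close>.
  After \<open>d\<close> messages, one transcript is shared by inputs of both values, so its output
  would have to be both 1 and 0.\<close>

lemma solves_within_few_inputs:
  assumes P: "solves_within P n d" and k: "0 < k" "(7/8) ^ k < 1 / (2 * real n)"
  shows "n < 6 * (8 * k) ^ (3 * d)"
proof (rule ccontr)
  assume "\<not> ?thesis"
  then have n: "6 * (8 * k) ^ (3 * d) \<le> n"
    by simp
  define m where "m = 8 * k"
  define T where "T = 3 * d"
  have m: "0 < m"
    using k by (simp add: m_def)
  have mT: "1 \<le> m ^ T"
    using m by simp
  \<comment> \<open>The factor 6 leaves room for \<open>2 * m ^ T\<close> examples in either half,
    and for an alphabet of \<open>4 * m ^ T\<close> examples and two bits.\<close>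
  have n': "6 * m ^ T \<le> n"
    using n by (simp add: m_def T_def)
  have sample: "\<exists>S. set S = labelled l A \<and> length S = h"
    if "A \<subseteq> all_points m T" "A \<noteq> {}" "2 * m ^ T \<le> h" for l A h
  proof (rule finite_nonempty_list_of_length)
    have fA: "finite A"
      using that finite_all_points finite_subset by blast
    then show "finite (labelled l A)"
      by (simp add: labelled_def)
    show "labelled l A \<noteq> {}"
      using that by (simp add: labelled_def)
    have "card (labelled l A) \<le> card A"
      unfolding labelled_def by (rule card_image_le[OF fA])
    also have "\<dots> \<le> 2 * m ^ T"
      using card_mono[OF finite_all_points that(1)] card_all_points le_trans by blast
    finally show "card (labelled l A) \<le> h"
      using that by linarith
  qed
  have "\<exists>S. set S = labelled False (array_points m T v) \<and> length S = n div 2" if "v \<in> arrays m T" for v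
    using that points_subset points_nonempty[OF m] n' by (intro sample) auto
  then obtain inA where inA: "\<And>v. v \<in> arrays m T \<Longrightarrow>
      set (inA v) = labelled False (array_points m T v) \<and> length (inA v) = n div 2"
    by metis
  have "\<exists>S. set S = labelled True (pointer_points m T w) \<and> length S = n - n div 2" if "w \<in> pointers m T" for w
    using that points_subset points_nonempty[OF m] n' by (intro sample) auto
  then obtain inB where inB: "\<And>w. w \<in> pointers m T \<Longrightarrow>
      set (inB w) = labelled True (pointer_points m T w) \<and> length (inB w) = n - n div 2"
    by metis
  define E where "E = labelled False (all_points m T) \<union> labelled True (all_points m T)"
  define C where "C = Ex ` E \<union> Bit ` UNIV"
  have fE: "finite E"
    using finite_all_points by (simp add: E_def labelled_def)
  have fC: "finite C"
    using fE by (simp add: C_def)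
  have "card E \<le> card (all_points m T) + card (all_points m T)"
    unfolding E_def labelled_def
    by (rule order_trans[OF card_Un_le]) (intro add_mono card_image_le finite_all_points)
  then have cE: "card E \<le> 4 * m ^ T"
    using card_all_points[of m T] by linarith
  have "card C \<le> card (Ex ` E) + card (range Bit)"
    unfolding C_def by (rule card_Un_le)
  also have "\<dots> \<le> card E + card (UNIV :: bool set)"
    by (intro add_mono card_image_le fE finite)
  finally have cC: "card C \<le> n"
    using cE mT n' by simp
  have valid: "msg_ok S (alice_msg P S t)" "msg_ok S (bob_msg P S t)" for S t
    using P by (auto simp: solves_within_def valid_protocol_def)
  have ok: "msg \<in> C" if "msg_ok S msg" "set S \<subseteq> E" for S msg
    using that by (cases msg) (auto simp: msg_ok_def C_def)
  have "hard m T (val T) (arrays m T) (pointers m T)"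
    unfolding embeds_def
    by (intro exI[of _ "arrays m T"] exI[of _ "pointers m T"] exI[of _ id]) auto
  moreover have "alice_msg P (inA v) t \<in> C" if "v \<in> arrays m T" for v t
  proof (rule ok[OF valid(1)])
    show "set (inA v) \<subseteq> E"
      using inA[OF that] points_subset[of v m T] that unfolding E_def labelled_def by blast
  qed
  moreover have "bob_msg P (inB w) t \<in> C" if "w \<in> pointers m T" for w t
  proof (rule ok[OF valid(2)])
    show "set (inB w) \<subseteq> E"
      using inB[OF that] points_subset[of _ m T w] that unfolding E_def labelled_def by blast
  qed
  moreover have "0 < n"
    using n' mT by linarith
  ultimately have "\<exists>X Y \<tau>. X \<subseteq> arrays m T \<and> Y \<subseteq> pointers m T \<and>
      (\<forall>x\<in>X. \<forall>y\<in>Y. run P (inA x) (inB y) d = \<tau>) \<and>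
      (hard m (3 * (d - d)) (val T) X Y \<or> hard m (3 * (d - d)) (\<lambda>y x. val T x y) Y X)"
    using k unfolding m_def T_def
    by (intro run_transcript_on_hard_rectangle[OF _ fC cC]) auto
  then obtain X Y \<tau> where XY: "X \<subseteq> arrays m T" "Y \<subseteq> pointers m T"
    and run: "\<And>x y. x \<in> X \<Longrightarrow> y \<in> Y \<Longrightarrow> run P (inA x) (inB y) d = \<tau>"
    and hd: "hard m 0 (val T) X Y \<or> hard m 0 (\<lambda>y x. val T x y) Y X"
    by auto
  have both: "\<exists>x\<in>X. \<exists>y\<in>Y. val T x y = l" for l
    using hd embeds_0_both_values[of m "3/4" "7/8" "val T" X Y l]
      embeds_0_both_values[of m "3/4" "7/8" "\<lambda>y x. val T x y" Y X l] by auto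
  have out: "(realizable_hp (inA x @ inB y) \<longrightarrow> out P \<tau>) \<and> (contradictory (inA x @ inB y) \<longrightarrow> \<not> out P \<tau>)"
    if "x \<in> X" "y \<in> Y" for x y
  proof -
    have "length (inA x) + length (inB y) = n"
      using inA inB XY that by fastforce
    then show ?thesis
      using P run[OF that] unfolding solves_within_def Let_def by metis
  qed
  obtain x y where xy: "x \<in> X" "y \<in> Y" "val T x y"
    using both[of True] by blast
  have xy': "x \<in> arrays m T" "y \<in> pointers m T"
    using xy XY by auto
  obtain s c where "\<forall>(a, b)\<in>array_points m T x. b < s * a + c" "\<forall>(a, b)\<in>pointer_points m T y. s * a + c < b"
    using separated_at_true[OF m xy' xy(3)] by blast
  then have "realizable_hp (inA x @ inB y)"
    using realizable_labelled inA[OF xy'(1)] inB[OF xy'(2)] by blast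
  then have "out P \<tau>"
    using out xy by blast
  obtain x' y' where z: "x' \<in> X" "y' \<in> Y" "\<not> val T x' y'"
    using both[of False] by blast
  have z': "x' \<in> arrays m T" "y' \<in> pointers m T"
    using z XY by auto
  have "contradictory (inA x' @ inB y')"
    using contradictory_labelled inA[OF z'(1)] inB[OF z'(2)] contact_at_false[OF z' z(3)] by blast
  then show False
    using out z \<open>out P \<tau>\<close> by blast
qed

section \<open>Choice of parameters and asymptotics\<close>

theorem theorem15:
  shows "\<exists>c > 0. \<exists>k::nat. \<exists>N::nat. \<forall>n \<ge> N. \<forall>P d.
           solves_within P n d \<longrightarrow> real d \<ge> c * ln (real n) / (ln (ln (real n))) ^ k"
proof -
  \<comment> \<open>The first bound keeps the denominator positive, the second absorbs the factor 6,
    and the third gives \<open>8 * k \<le> ln n ^ 2\<close> for the \<open>k\<close> chosen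
    below.\<close>
  have "eventually (\<lambda>n::nat. 2 \<le> ln (ln (real n))) sequentially"
    "eventually (\<lambda>n::nat. 2 * ln 6 \<le> ln (real n)) sequentially"
    "eventually (\<lambda>n::nat. 8 * (16 * ln (real n) + 1) \<le> ln (real n) ^ 2) sequentially"
    by real_asymp+
  then have "eventually (\<lambda>n::nat. 2 \<le> ln (ln (real n)) \<and> 2 * ln 6 \<le> ln (real n) \<and>
      8 * (16 * ln (real n) + 1) \<le> ln (real n) ^ 2) sequentially"
    by eventually_elim blast
  then obtain N where N: "\<And>n::nat. N \<le> n \<Longrightarrow> 2 \<le> ln (ln (real n)) \<and> 2 * ln 6 \<le> ln (real n) \<and>
      8 * (16 * ln (real n) + 1) \<le> ln (real n) ^ 2"
    by (auto simp: eventually_sequentially)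
  have "1/12 * ln (real n) / (ln (ln (real n))) ^ 1 \<le> d"
    if n: "max N 3 \<le> n" and P: "solves_within P n d" for n P d
  proof -
    \<comment> \<open>The factor 16 gives
      \<open>(7/8) ^ k \<le> exp (- k / 8) \<le> 1 / n^2\<close>, which is below
      \<open>1 / (2 n)\<close> once \<open>n \<ge> 3\<close>.\<close>
    define k where "k = nat \<lceil>16 * ln (real n)\<rceil>"
    have n3: "3 \<le> n" and big: "2 \<le> ln (ln (real n))" "2 * ln 6 \<le> ln (real n)"
      "8 * (16 * ln (real n) + 1) \<le> ln (real n) ^ 2"
      using n N[of n] by auto
    have ln_pos: "0 < ln (real n)"
      using n3 by simp
    then have k: "16 * ln (real n) \<le> real k" "real k \<le> 16 * ln (real n) + 1"
      unfolding k_def by linarith+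
    then have k0: "0 < k"
      using ln_pos by (intro Nat.gr0I) auto
    have "(7/8 :: real) ^ k \<le> exp (- (1/8)) ^ k"
      using exp_ge_add_one_self[of "- (1/8) :: real"] by (intro power_mono) auto
    also have "\<dots> = exp (- (real k / 8))"
      by (simp add: exp_of_nat_mult[symmetric])
    also have "\<dots> \<le> exp (- (2 * ln (real n)))"
      using k by simp
    also have "\<dots> = 1 / (real n * real n)"
      using n3 by (simp add: exp_minus exp_double power2_eq_square divide_inverse)
    also have "\<dots> < 1 / (2 * real n)"
      using n3 by (simp add: field_simps)
    finally have "(7/8 :: real) ^ k < 1 / (2 * real n)" .
    then have "n < 6 * (8 * k) ^ (3 * d)"
      using solves_within_few_inputs[OF P k0] by blast
    then have "real n < 6 * real (8 * k) ^ (3 * d)"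
      by (metis of_nat_less_iff of_nat_mult of_nat_power of_nat_numeral)
    then have "ln (real n) < ln (6 * real (8 * k) ^ (3 * d))"
      using n3 by simp
    also have "\<dots> = ln 6 + 3 * d * ln (8 * real k)"
      using k0 by (subst ln_mult) (simp_all add: ln_realpow del: of_nat_mult flip: of_nat_mult)
    also have "ln (8 * real k) \<le> ln (ln (real n) ^ 2)"
      using k0 k big ln_pos by simp
    also have "\<dots> = 2 * ln (ln (real n))"
      using ln_pos by (simp add: ln_realpow)
    finally have "ln (real n) < ln 6 + 6 * d * ln (ln (real n))"
      by (simp add: mult_left_mono)
    \<comment> \<open>As \<open>ln 6\<close> is at most half of \<open>ln n\<close>, the other half
      is at most \<open>6 * d * ln (ln n)\<close>; this is the source of the constant 1/12.\<close>
    then have "ln (real n) \<le> 12 * (d * ln (ln (real n)))"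
      using big by linarith
    then show ?thesis
      using big by (simp add: divide_simps mult.commute)
  qed
  then show ?thesis
    by (intro exI[of _ "1/12"] conjI exI[of _ 1] exI[of _ "max N 3"]) auto
qed

end
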